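(* Let $n = p_1^{\alpha_1}\cdots p_r^{\alpha_r}$ be the prime factorisation of a positive integer $n$ (distinct primes, $\alpha_i>0$), and let $e_1 \mid e_2 \mid \dots \mid e_n$ be the elementary divisors of $A_n$; put $e_0 = 1$. Then: (1) the $n$-tuple $\left(e_1, \frac{e_2}{e_1}, \dots, \frac{e_n}{e_{n-1}}\right)$ is a permutation of the $n$-tuple consisting of $p_1$ repeated $\alpha_1$ times, $p_2$ repeated $\alpha_2$ times, $\dots$, $p_r$ repeated $\alpha_r$ times, and $1$ repeated $n - \sum_i \alpha_i$ times; (2) for $1\le j\le n$ and $1 \le i \le r$, the ratio $e_j/e_{j-1}$ equals $p_i$ if and only if $j = n - \frac{n}{p_i^t} + 1$ for some integer $t$ with $1 \le t \le \alpha_i$.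
   Context: For a positive integer $k$, let $\Phi_d$ denote the $d$th cyclotomic polynomial and let $\Psi_k : \mathbf{Z}[X]/(X^k-1) \to \bigoplus_{d \mid k} \mathbf{Z}[X]/(\Phi_d(X))$ be the natural map $f \bmod (X^k-1) \mapsto \bigoplus_{d\mid k} f \bmod \Phi_d(X)$, with bases $(1,\overline{X},\dots,\overline{X}^{k-1})$ on the domain, $(1,\overline{X},\dots,\overline{X}^{\phi(d)-1})$ on each summand, summands ordered by increasing $d$; $A_k$ is the matrix of $\Psi_k$ in these bases. Elementary divisors are those of the Smith normal form over $\mathbf{Z}$, taken non-negative. *)

theory Defs
  imports Complex_Main "HOL-Computational_Algebra.Polynomial" "HOL-Computational_Algebra.Primes"
    "HOL-Number_Theory.Totient" "HOL-Library.Multiset"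
    "Jordan_Normal_Form.Determinant"
begin

definition cyclo_complex :: "nat \<Rightarrow> complex poly" where
  "cyclo_complex d = (\<Prod>k\<in>{k. k < d \<and> coprime k d}. [:- cis (2 * pi * real k / real d), 1:])"

definition cyclotomic :: "nat \<Rightarrow> int poly" where
  "cyclotomic d = (THE p. map_poly of_int p = cyclo_complex d)"

(* Row index list of A_k: pairs (d, i) with d | k in increasing order of d and i < phi(d);
   row (d,i) corresponds to the basis vector Xbar^i of Z[X]/(Phi_d). *)
definition psi_rows :: "nat \<Rightarrow> (nat \<times> nat) list" where
  "psi_rows k = concat (map (\<lambda>d. map (\<lambda>i. (d, i)) [0..<totient d]) (filter (\<lambda>d. d dvd k) [1..<Suc k]))"

(* The matrix A_k of Psi_k: column j is the image of Xbar^j, i.e. the coordinates of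
   X^j mod Phi_d (Phi_d is monic, so pseudo_mod is the ordinary remainder). *)
definition A_mat :: "nat \<Rightarrow> int mat" where
  "A_mat k = mat k k (\<lambda>(r, j). case psi_rows k ! r of (d, i) \<Rightarrow> coeff (pseudo_mod (monom 1 j) (cyclotomic d)) i)"

definition unimodular :: "nat \<Rightarrow> int mat \<Rightarrow> bool" where
  "unimodular n P \<longleftrightarrow> P \<in> carrier_mat n n \<and> (det P = 1 \<or> det P = -1)"

(* e 0, ..., e (n-1) are the diagonal entries of a Smith normal form of the n x n matrix A,
   i.e. e_1, ..., e_n in the paper's numbering. *)
definition is_smith_diag :: "nat \<Rightarrow> int mat \<Rightarrow> (nat \<Rightarrow> int) \<Rightarrow> bool" where
  "is_smith_diag n A e \<longleftrightarrow>
     (\<exists>P Q. unimodular n P \<and> unimodular n Q \<and>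
            P * A * Q = mat n n (\<lambda>(i, j). if i = j then e i else 0)) \<and>
     (\<forall>i<n. 0 \<le> e i) \<and> (\<forall>i. Suc i < n \<longrightarrow> e i dvd e (Suc i))"

end

theory Submission
  imports Defs "Jordan_Normal_Form.Char_Poly"
begin

text \<open>
  Fix a prime p and write n = p^a m with p not dividing m. The set of x with A x = 0 modulo p^s,
  reduced modulo p, has p^c elements, where c is the number of elementary divisors divisible by p^s.
  Reading x as the polynomial f of degree less than n, the condition says that f lies in the
  ideal generated by p^s and the d-th cyclotomic polynomial for every d dividing n.
  For s at most a, the reductions modulo p of these f are exactly the multiples of
  (X^n - 1) / (X^k - 1) with k = n/p^s, that is, the k-periodic vectors x, so that c = k;
  for larger s only 0 remains. As the elementary divisors form a divisibility chain,
  p^s divides exactly the last n/p^s of them, which determines all quotients.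
\<close>

text \<open>The divisors d of n cannot be treated together by the Chinese remainder theorem: modulo
  p the cyclotomic polynomials for d and pd have the same roots. Distinct indices with the same
  power of p are harmless, since the ideal generated by two such polynomials contains an integer
  prime to p. The divisors are therefore removed in layers, highest power of p first, each layer
  costing one factor p. The kernel modulo p^s is reduced modulo p before it is counted because its
  own size mixes the contributions of all powers up to p^s; after reduction, each coordinate of the
  diagonal form is either free or zero. Complex roots of unity serve only to obtain the product
  formula for X^n - 1 and the integrality of its factors.\<close>

section \<open>Division by monic polynomials\<close>

lemma monic_division:
  fixes f g :: "'a :: idom poly"
  assumes "monic g"
  obtains q r where "f = g * q + r" "r = 0 \<or> degree r < degree g"
proof -
  have "g \<noteq> 0" using assms by auto
  moreover obtain q r where "pseudo_divmod f g = (q, r)" by force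
  ultimately show ?thesis
    using pseudo_divmod[of g f q r] assms that by simp
qed

lemma pseudo_mod_monic:
  fixes f g :: "'a :: idom poly"
  assumes "monic g"
  shows "g dvd f - pseudo_mod f g" "pseudo_mod f g = 0 \<or> degree (pseudo_mod f g) < degree g"
proof -
  have "g \<noteq> 0" using assms by auto
  moreover obtain q r where "pseudo_divmod f g = (q, r)" by force
  ultimately show "g dvd f - pseudo_mod f g" "pseudo_mod f g = 0 \<or> degree (pseudo_mod f g) < degree g"
    using pseudo_divmod[of g f q r] assms by (simp_all add: pseudo_mod_def)
qed

lemma dvd_degree_less_imp_0:
  fixes f g :: "'a :: idom poly"
  assumes "g dvd f" "degree f < degree g"
  shows "f = 0"
  using assms dvd_imp_degree_le by (metis leD)

lemma degree_monom_diff_1: "n > 0 \<Longrightarrow> degree (monom 1 n - 1 :: 'a :: comm_ring_1 poly) = n"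
  using degree_add_eq_left[of "-1" "monom 1 n :: 'a poly"] by (simp add: degree_monom_eq)

lemma monic_monom_diff_1: "n > 0 \<Longrightarrow> monic (monom 1 n - 1 :: 'a :: comm_ring_1 poly)"
  by (simp add: degree_monom_diff_1)

section \<open>Cyclotomic polynomials\<close>

text \<open>X^n - 1 has no multiple roots, so it is the product of the linear factors at exp(2 pi i
  k/n). Writing each k/n in lowest terms as j/d groups these factors by d.\<close>

lemma cyclo_complex_prod:
  assumes "n > 0"
  shows "(\<Prod>d | d dvd n. cyclo_complex d) = monom 1 n - 1"
proof -
  define p :: "complex poly" where "p = monom 1 n - 1"
  have deg: "degree p = n"
    unfolding p_def using assms by (rule degree_monom_diff_1)
  have lead: "lead_coeff p = 1"
    unfolding p_def using assms by (rule monic_monom_diff_1)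
  have root: "poly p z = 0 \<longleftrightarrow> z ^ n = 1" for z
    by (simp add: p_def poly_monom)
  have "rsquarefree p"
    unfolding rsquarefree_roots
  proof (intro allI notI)
    fix z assume z: "poly p z = 0 \<and> poly (pderiv p) z = 0"
    have "z \<noteq> 0" using z root assms by (auto simp: power_0_left)
    moreover have "pderiv p = monom (of_nat n) (n - 1)"
      by (simp add: p_def pderiv_diff pderiv_monom)
    ultimately show False using z assms by (simp add: poly_monom)
  qed
  from complex_poly_decompose_rsquarefree[OF this] lead
  have "p = (\<Prod>z | z ^ n = 1. [:-z, 1:])"
    by (simp add: root)
  also have "\<dots> = (\<Prod>k<n. [:- cis (2 * pi * real k / real n), 1:])"
    by (rule prod.reindex_bij_betw[OF bij_betw_roots_unity[OF assms], symmetric])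
  also have "\<dots> = (\<Prod>(d, j)\<in>(SIGMA d:{d. d dvd n}. {j. j < d \<and> coprime j d}). [:- cis (2 * pi * real j / real d), 1:])"
  proof (rule prod.reindex_bij_witness[of _ "\<lambda>(d, j). j * (n div d)" "\<lambda>k. (n div gcd k n, k div gcd k n)"], goal_cases)
    case (1 k)
    obtain a b where "k = a * gcd k n" "n = b * gcd k n" by (metis dvd_div_mult_self gcd_dvd1 gcd_dvd2)
    moreover have "gcd k n > 0" using assms by simp
    moreover have "b > 0" using assms calculation by (metis mult_0 not_gr0)
    ultimately have "n div (n div gcd k n) = gcd k n" "k div gcd k n * gcd k n = k"
      by (metis nonzero_mult_div_cancel_left nonzero_mult_div_cancel_right not_gr0, simp)
    then show ?case by simp
  next
    case (2 k)
    have "gcd k n > 0" using assms by simp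
    have "k div gcd k n * gcd k n < n div gcd k n * gcd k n" using 2 by simp
    then have "k div gcd k n < n div gcd k n" by (rule mult_less_cancel2[THEN iffD1, THEN conjunct2])
    with 2 show ?case using assms by (auto simp: div_gcd_coprime div_dvd_iff_mult)
  next
    case (3 x)
    then obtain d j where x: "x = (d, j)" "d dvd n" "j < d" "coprime j d" by auto
    then have "d > 0" by simp
    obtain m where n: "n = d * m" using x by auto
    have "m > 0" using assms n by simp
    have "gcd (j * m) (d * m) = m" using x
      by (simp add: gcd_mult_right coprime_iff_gcd_eq_1 gcd.commute)
    then show ?case using x n \<open>d > 0\<close> \<open>m > 0\<close> by simp
  next
    case (4 x)
    then obtain d j where x: "x = (d, j)" "d dvd n" "j < d" "coprime j d" by auto
    then have "d > 0" by simp
    obtain m where n: "n = d * m" using x by auto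
    show ?case using x n \<open>d > 0\<close> assms by simp
  next
    case (5 k)
    have g: "gcd k n > 0" using assms by simp
    have "real (k div gcd k n) / real (n div gcd k n) = real k / real n"
      using g assms by (simp add: real_of_nat_div)
    then have "2 * pi * real (k div gcd k n) / real (n div gcd k n) = 2 * pi * real k / real n"
      by (metis times_divide_eq_right)
    then show ?case by simp
  qed
  also have "\<dots> = (\<Prod>d | d dvd n. cyclo_complex d)"
    unfolding cyclo_complex_def using assms by (subst prod.Sigma) auto
  finally show ?thesis by (simp add: p_def)
qed

lemma monic_cyclo_complex: "monic (cyclo_complex d)"
  unfolding cyclo_complex_def by (rule monic_prod) auto

lemma degree_cyclo_complex:
  assumes "d > 0"
  shows "degree (cyclo_complex d) = totient d"
proof -
  have "degree (cyclo_complex d) = card {k. k < d \<and> coprime k d}"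
    unfolding cyclo_complex_def by (subst degree_prod_sum_eq) auto
  \<comment> \<open>For d = 1 the index set is {0} while \<open>totatives\<close> gives {1}; for
    larger d, 0 is not coprime to d and the two sets coincide.\<close>
  also have "\<dots> = totient d"
  proof (cases "d = 1")
    case True
    have "{k. k < d \<and> coprime k d} = {0}" using True by auto
    then show ?thesis using True by simp
  next
    case False
    then have "{k. k < d \<and> coprime k d} = totatives d"
      using assms by (auto simp: totatives_def le_less intro: Nat.gr0I)
    then show ?thesis by (simp add: totient_def)
  qed
  finally show ?thesis .
qed

text \<open>By induction the factors for the proper divisors multiply to a monic integral
  \<open>B\<close>. Dividing X^n - 1 by \<open>B\<close> over the integers and comparing with the
  factorisation over the complex numbers, the remainder is a multiple of \<open>B\<close> of smaller
  degree, hence zero, and the quotient is the factor sought.\<close>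

lemma cyclo_complex_integral:
  assumes "d > 0"
  shows "\<exists>p. map_poly of_int p = cyclo_complex d"
  using assms
proof (induction d rule: less_induct)
  case (less n)
  define D where "D = {d. d dvd n \<and> d \<noteq> n}"
  have fin: "finite D" using less.prems by (auto simp: D_def)
  have "\<forall>d\<in>D. \<exists>p. map_poly of_int p = cyclo_complex d"
    using less.IH less.prems
    by (auto simp: D_def dvd_imp_le nat_dvd_not_less intro!: dvd_pos_nat[of n] le_neq_implies_less)
  then obtain P where P: "\<And>d. d \<in> D \<Longrightarrow> map_poly of_int (P d) = cyclo_complex d" by metis
  have monicP: "monic (P d)" if "d \<in> D" for d
    using monic_cyclo_complex[of d] P[OF that, symmetric] by simp
  define B where "B = prod P D"
  have monB: "monic B" unfolding B_def using monicP by (rule monic_prod)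
  have BC: "map_poly of_int B = prod cyclo_complex D"
    unfolding B_def using P by (simp add: of_int_poly_hom.hom_prod)
  have "insert n D = {d. d dvd n}" "n \<notin> D" by (auto simp: D_def)
  then have *: "monom 1 n - 1 = cyclo_complex n * map_poly of_int B"
    using cyclo_complex_prod[OF less.prems] fin BC by (metis prod.insert)
  obtain q r where qr: "monom 1 n - 1 = B * q + r" "r = 0 \<or> degree r < degree B"
    using monic_division[OF monB] by blast
  have "map_poly of_int (monom 1 n - 1 :: int poly) = (monom 1 n - 1 :: complex poly)"
    by (simp add: of_int_poly_hom.hom_minus)
  then have "cyclo_complex n * map_poly of_int B = map_poly of_int (B * q + r)"
    using * qr(1) by simp
  then have eq: "map_poly of_int B * (cyclo_complex n - map_poly of_int q) = map_poly of_int r"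
    by (simp add: of_int_poly_hom.hom_add of_int_poly_hom.hom_mult algebra_simps)
  have r0: "map_poly of_int r = (0 :: complex poly)"
  proof (cases "r = 0")
    case False
    then have "degree (map_poly of_int r :: complex poly) < degree (map_poly of_int B :: complex poly)"
      using qr(2) by simp
    then show ?thesis using eq dvd_degree_less_imp_0 dvdI by metis
  qed simp
  have "B \<noteq> 0" using monB by auto
  then have "cyclo_complex n = map_poly of_int q" using eq r0 by simp
  then show ?case by metis
qed

lemma of_int_poly_cyclotomic:
  assumes "d > 0"
  shows "map_poly of_int (cyclotomic d) = cyclo_complex d"
proof -
  obtain p where p: "map_poly of_int p = cyclo_complex d" using cyclo_complex_integral[OF assms] by blast
  show ?thesis unfolding cyclotomic_def
  proof (rule theI[where P = "\<lambda>q. map_poly of_int q = cyclo_complex d", OF p])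
    fix q :: "int poly" assume "map_poly of_int q = cyclo_complex d"
    then have "map_poly of_int q = (map_poly of_int p :: complex poly)" using p by simp
    then show "q = p" by (rule of_int_poly_hom.injectivity)
  qed
qed

lemma degree_cyclotomic: "d > 0 \<Longrightarrow> degree (cyclotomic d) = totient d"
  by (metis degree_cyclo_complex of_int_hom.degree_map_poly_hom of_int_poly_cyclotomic)

lemma monic_cyclotomic: "d > 0 \<Longrightarrow> monic (cyclotomic d)"
  using monic_cyclo_complex[of d] by (simp flip: of_int_poly_cyclotomic)

lemma cyclotomic_prod:
  assumes "n > 0"
  shows "(\<Prod>d | d dvd n. cyclotomic d) = monom 1 n - 1"
proof -
  have "map_poly of_int (\<Prod>d | d dvd n. cyclotomic d) = (\<Prod>d | d dvd n. cyclo_complex d)"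
    unfolding of_int_poly_hom.hom_prod using assms
    by (intro prod.cong) (auto simp: of_int_poly_cyclotomic dvd_pos_nat)
  also have "\<dots> = map_poly of_int (monom 1 n - 1)"
    using cyclo_complex_prod[OF assms] by (simp add: of_int_poly_hom.hom_minus)
  finally show ?thesis by simp
qed

section \<open>Ideals generated by an integer and a polynomial\<close>

definition in_ideal :: "int \<Rightarrow> int poly \<Rightarrow> int poly \<Rightarrow> bool" where
  "in_ideal N g f \<longleftrightarrow> (\<exists>u v. f = g * u + smult N v)"

lemma in_idealI: "f = g * u + smult N v \<Longrightarrow> in_ideal N g f"
  by (auto simp: in_ideal_def)

text \<open>Replacing \<open>v\<close> by its remainder \<open>r\<close> modulo the monic
  \<open>g\<close> makes \<open>f - smult N r\<close> a multiple of \<open>g\<close> of smaller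
  degree than \<open>g\<close>, hence zero.\<close>

lemma in_ideal_degree_less:
  assumes "in_ideal N g f" "monic g" "degree f < degree g"
  shows "\<exists>w. f = smult N w"
proof -
  obtain u v where uv: "f = g * u + smult N v" using assms by (auto simp: in_ideal_def)
  obtain q r where qr: "v = g * q + r" "r = 0 \<or> degree r < degree g"
    using monic_division[OF assms(2)] by blast
  have eq: "f - smult N r = g * (u + smult N q)"
    using uv qr(1) by (simp add: algebra_simps smult_add_right)
  have "degree (smult N r) < degree g"
    using qr(2) assms(3) degree_smult_le[of N r] by auto
  then have "degree (f - smult N r) < degree g"
    using assms(3) by (rule degree_diff_less[rotated])
  then have "f - smult N r = 0"
    using eq dvd_degree_less_imp_0 dvdI by metis
  then show ?thesis by auto
qed

text \<open>For monic \<open>g\<close> the quotient ring of Z[X] by \<open>g\<close> is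
  torsion-free: a remainder killed by \<open>c\<close> is zero.\<close>

lemma in_ideal_cancel:
  assumes "in_ideal (c * N) g (smult c h)" "monic g" "c \<noteq> 0"
  shows "in_ideal N g h"
proof -
  obtain x y where xy: "smult c h = g * x + smult (c * N) y" using assms by (auto simp: in_ideal_def)
  obtain q r where qr: "h - smult N y = g * q + r" "r = 0 \<or> degree r < degree g"
    using monic_division[OF assms(2)] by blast
  have "smult c (h - smult N y) = g * x" using xy by (simp add: smult_diff_right)
  then have "smult c r = g * (x - smult c q)"
    unfolding qr(1) by (simp add: algebra_simps smult_add_right)
  moreover have "smult c r = 0 \<or> degree (smult c r) < degree g" using qr(2) by auto
  ultimately have "smult c r = 0" using dvd_degree_less_imp_0 dvdI by metis
  then have "r = 0" using assms(3) by simp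
  then have "h = g * q + smult N y" using qr(1) by (simp add: algebra_simps)
  then show ?thesis by (rule in_idealI)
qed

section \<open>Comaximality at a prime and the Chinese remainder theorem\<close>

text \<open>Comaximality after localising the integers at p. The constant \<open>c\<close> cannot be
  replaced by 1: X - 1 and X^2 + X + 1, for instance, only generate an ideal containing 3.\<close>

definition coprime_at :: "int \<Rightarrow> int poly \<Rightarrow> int poly \<Rightarrow> bool" where
  "coprime_at p g h \<longleftrightarrow> (\<exists>c u v. coprime c p \<and> [:c:] = g * u + h * v)"

lemma coprime_at_commute: "coprime_at p g h \<Longrightarrow> coprime_at p h g"
  unfolding coprime_at_def by (metis add.commute)

lemma coprime_at_mult:
  assumes "coprime_at p g h1" "coprime_at p g h2"
  shows "coprime_at p g (h1 * h2)"
proof -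
  obtain c1 u1 v1 where 1: "coprime c1 p" "[:c1:] = g * u1 + h1 * v1"
    using assms by (auto simp: coprime_at_def)
  obtain c2 u2 v2 where 2: "coprime c2 p" "[:c2:] = g * u2 + h2 * v2"
    using assms by (auto simp: coprime_at_def)
  have "[:c1 * c2:] = [:c1:] * [:c2:]" by simp
  also have "\<dots> = g * (u1 * g * u2 + u1 * h2 * v2 + h1 * v1 * u2) + (h1 * h2) * (v1 * v2)"
    unfolding 1(2) 2(2) by (simp add: algebra_simps)
  finally show ?thesis unfolding coprime_at_def using 1(1) 2(1) coprime_mult_left_iff by blast
qed

lemma coprime_at_prod:
  assumes "finite S" "\<And>x. x \<in> S \<Longrightarrow> coprime_at p g (F x)"
  shows "coprime_at p g (prod F S)"
  using assms
proof (induction S rule: finite_induct)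
  case empty
  have "[:1:] = g * 0 + 1 * (1 :: int poly)" by simp
  then show ?case unfolding coprime_at_def by (metis coprime_1_left prod.empty)
qed (auto intro: coprime_at_mult)

text \<open>In c f = g u f + h v f, substituting for \<open>f\<close> its expression from the other
  ideal puts both summands into the ideal of \<open>g * h\<close> and p^s; then \<open>c\<close> is
  inverted modulo p^s.\<close>

lemma in_ideal_mult:
  assumes "in_ideal (p ^ s) g f" "in_ideal (p ^ s) h f" "coprime_at p g h"
  shows "in_ideal (p ^ s) (g * h) f"
proof -
  let ?N = "p ^ s"
  obtain x y where xy: "f = g * x + smult ?N y" using assms by (auto simp: in_ideal_def)
  obtain x' y' where xy': "f = h * x' + smult ?N y'" using assms by (auto simp: in_ideal_def)
  obtain c u v where c: "coprime c p" "[:c:] = g * u + h * v" using assms by (auto simp: coprime_at_def)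
  have "coprime c ?N" using c(1) by simp
  then obtain b t where bt: "b * c + t * ?N = 1" by (metis bezout_int coprime_imp_gcd_eq_1)
  have "smult c f = [:c:] * f" by simp
  also have "\<dots> = g * u * f + h * v * f" unfolding c(2) by (simp add: algebra_simps)
  also have "g * u * f = g * h * (u * x') + smult ?N (g * u * y')"
    by (subst xy') (simp add: algebra_simps)
  also have "h * v * f = g * h * (v * x) + smult ?N (h * v * y)"
    by (subst xy) (simp add: algebra_simps)
  finally have cf: "smult c f = g * h * (u * x' + v * x) + smult ?N (g * u * y' + h * v * y)"
    by (simp add: algebra_simps smult_add_right)
  have "f = smult (b * c + t * ?N) f" using bt by simp
  also have "\<dots> = smult b (smult c f) + smult ?N (smult t f)" by (simp add: smult_add_left mult.commute)
  also have "\<dots> = g * h * smult b (u * x' + v * x) + smult ?N (smult b (g * u * y' + h * v * y) + smult t f)"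
    unfolding cf by (simp add: algebra_simps smult_add_right)
  finally show ?thesis by (rule in_idealI)
qed

lemma in_ideal_prod:
  assumes "finite S" "\<And>x. x \<in> S \<Longrightarrow> in_ideal (p ^ s) (F x) f"
    and "\<And>x y. x \<in> S \<Longrightarrow> y \<in> S \<Longrightarrow> x \<noteq> y \<Longrightarrow> coprime_at p (F x) (F y)"
  shows "in_ideal (p ^ s) (prod F S) f"
  using assms
proof (induction S rule: finite_induct)
  case empty
  show ?case by (rule in_idealI[where u = f and v = 0]) simp
next
  case (insert x S)
  then have "in_ideal (p ^ s) (F x * prod F S) f"
    by (intro in_ideal_mult coprime_at_prod) auto
  then show ?case using insert by simp
qed

section \<open>The quotients of X^kq - 1 by X^k - 1\<close>

definition geo :: "nat \<Rightarrow> nat \<Rightarrow> int poly" where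
  "geo k q = (\<Sum>i<q. monom 1 (k * i))"

lemma geo_mult: "(monom 1 k - 1) * geo k q = monom 1 (k * q) - 1"
  by (induction q) (simp_all add: geo_def algebra_simps mult_monom)

lemma monom_diff_1_nonzero: "k > 0 \<Longrightarrow> monom 1 k - 1 \<noteq> (0 :: int poly)"
  using monic_monom_diff_1[of k, where 'a = int] by auto

text \<open>Each of the q summands is 1 modulo X^k - 1. This congruence is the source of every power
  of p in the kernel computation.\<close>

lemma geo_cong: "monom 1 k - 1 dvd geo k q - [:int q:]"
proof -
  have "geo k q - [:int q:] = (\<Sum>i<q. monom 1 (k * i) - 1)"
    by (simp add: geo_def sum_subtractf of_nat_poly)
  also have "monom 1 k - 1 dvd \<dots>"
    by (intro dvd_sum) (metis geo_mult dvd_triv_left)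
  finally show ?thesis .
qed

lemma geo_1 [simp]: "geo k (Suc 0) = 1"
  by (simp add: geo_def)

lemma geo_geo:
  assumes "k > 0"
  shows "geo (k * a) b * geo k a = geo k (a * b)"
proof -
  have "(monom 1 k - 1) * (geo (k * a) b * geo k a) = (monom 1 k - 1) * geo k (a * b)"
    using geo_mult[of k a] geo_mult[of "k * a" b] geo_mult[of k "a * b"]
    by (metis mult.assoc mult.commute)
  then show ?thesis using monom_diff_1_nonzero[OF assms] by simp
qed

section \<open>Cyclotomic factors of the quotients and their Bezout constants\<close>

lemma cyclotomic_dvd:
  assumes "d dvd n" "n > 0"
  shows "cyclotomic d dvd monom 1 n - 1"
  unfolding cyclotomic_prod[OF assms(2), symmetric] using assms by (intro dvd_prodI) auto

lemma geo_cyclotomic: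
  assumes "k > 0" "q > 0"
  shows "geo k q = (\<Prod>d | d dvd k * q \<and> \<not> d dvd k. cyclotomic d)"
proof -
  have eq: "{d. d dvd k * q} = {d. d dvd k} \<union> {d. d dvd k * q \<and> \<not> d dvd k}" by auto
  have fin: "finite {d. d dvd k * q}" using assms by simp
  have "(monom 1 k - 1) * geo k q = (\<Prod>d | d dvd k * q. cyclotomic d)"
    unfolding geo_mult using assms by (simp add: cyclotomic_prod)
  also have "\<dots> = (\<Prod>d | d dvd k. cyclotomic d) * (\<Prod>d | d dvd k * q \<and> \<not> d dvd k. cyclotomic d)"
    unfolding eq by (rule prod.union_disjoint) (use fin eq assms in \<open>auto\<close>)
  also have "(\<Prod>d | d dvd k. cyclotomic d) = monom 1 k - 1"
    using assms by (simp add: cyclotomic_prod)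
  finally show ?thesis using monom_diff_1_nonzero[OF assms(1)] by simp
qed

text \<open>With g = gcd(D, D'), the ideal contains X^g - 1. It also contains
  \<open>geo g (D div g)\<close>, which is divisible by the D-th cyclotomic polynomial because D
  does not divide g, and which is D/g modulo X^g - 1.\<close>

lemma cyclotomic_bezout:
  assumes "D > 0" "D' > 0" "\<not> D dvd D'"
  shows "\<exists>u v. [:int (D div gcd D D'):] = cyclotomic D * u + cyclotomic D' * v"
proof -
  define g where "g = gcd D D'"
  have g: "g > 0" "g dvd D" "D = g * (D div g)" using assms by (auto simp: g_def)
  have "\<not> D dvd g" using assms(3) by (auto simp: g_def)
  \<comment> \<open>The exponents follow Euclid's algorithm: X^g - 1 = (X^(Dx) - 1) - (X^(D'y) - 1)
    X^g.\<close>
  obtain x y where "D * x = D' * y + g" using bezout_nat[of D D'] assms by (auto simp: g_def)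
  then have "monom 1 g - 1 = (monom 1 (D * x) - 1) - (monom 1 (D' * y) - 1) * (monom 1 g :: int poly)"
    by (simp add: algebra_simps mult_monom)
  then have "monom 1 g - 1 = (monom 1 D - 1) * geo D x - (monom 1 D' - 1) * (geo D' y * monom 1 g)"
    using geo_mult[of D x] geo_mult[of D' y] by (simp add: mult.assoc[symmetric])
  moreover obtain r where "monom 1 D - 1 = cyclotomic D * r" using cyclotomic_dvd[of D D] assms by auto
  moreover obtain r' where "monom 1 D' - 1 = cyclotomic D' * r'" using cyclotomic_dvd[of D' D'] assms by auto
  ultimately have X: "monom 1 g - 1 = cyclotomic D * (r * geo D x) - cyclotomic D' * (r' * geo D' y * monom 1 g)"
    by (simp add: mult.assoc)
  have "D div g > 0" using g assms by (metis mult_0_right not_gr0)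
  then have "cyclotomic D dvd geo g (D div g)"
    using g \<open>\<not> D dvd g\<close> assms by (subst geo_cyclotomic) (auto intro!: dvd_prodI)
  then obtain t where t: "geo g (D div g) = cyclotomic D * t" by auto
  obtain w where w: "geo g (D div g) - [:int (D div g):] = (monom 1 g - 1) * w"
    using geo_cong by (meson dvdE)
  then have "[:int (D div g):] = cyclotomic D * t - (monom 1 g - 1) * w"
    unfolding t[symmetric] by (simp add: algebra_simps)
  also have "\<dots> = cyclotomic D * (t - r * geo D x * w) + cyclotomic D' * (r' * geo D' y * monom 1 g * w)"
    unfolding X by (simp add: algebra_simps)
  finally show ?thesis unfolding g_def by blast
qed

text \<open>The common factor \<open>P\<close> cancels from the Bezout constant, leaving a divisor
  of \<open>d\<close> or of \<open>d'\<close>, hence a number prime to p. Taking for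
  \<open>P\<close> a power of p treats all indices with that p-part.\<close>

lemma cyclotomic_coprime_at:
  fixes p P d d' :: nat
  assumes "d > 0" "d' > 0" "P > 0" "coprime d p" "coprime d' p" "d \<noteq> d'"
  shows "coprime_at (int p) (cyclotomic (P * d)) (cyclotomic (P * d'))"
proof -
  have *: "coprime_at (int p) (cyclotomic (P * a)) (cyclotomic (P * b))"
    if ab: "a > 0" "b > 0" "coprime a p" "\<not> a dvd b" for a b
  proof -
    have "P * a div gcd (P * a) (P * b) = a div gcd a b"
      using assms(3) by (simp add: gcd_mult_left)
    then obtain u v where uv: "[:int (a div gcd a b):] = cyclotomic (P * a) * u + cyclotomic (P * b) * v"
      using cyclotomic_bezout[of "P * a" "P * b"] assms(3) ab by auto
    have "a div gcd a b dvd a" by (metis dvd_div_mult_self dvd_triv_left gcd_dvd1)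
    then have "coprime (int (a div gcd a b)) (int p)"
      using ab(3) coprime_divisors[OF _ dvd_refl] by (metis coprime_int_iff)
    then show ?thesis using uv unfolding coprime_at_def by blast
  qed
  \<comment> \<open>The Bezout identity needs an index that does not divide the other; as
    \<open>d\<close> and \<open>d'\<close> differ, at least one order qualifies.\<close>
  show ?thesis
  proof (cases "d dvd d'")
    case True
    then have "\<not> d' dvd d" using assms(6) dvd_antisym by blast
    then show ?thesis using *[of d' d] assms coprime_at_commute by blast
  qed (use *[of d d'] assms in blast)
qed

text \<open>The quotient H of X^n - 1 by X^(n/p) - 1 is the product of the cyclotomic factors that are
  pairwise coprime at p, so f = H h modulo p^s; as H = p modulo X^(n/p) - 1, the cofactor h
  inherits the hypothesis with p^(s-1) and n/p in place of p^s and n.\<close>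

lemma all_cyclotomic_in_ideal_imp:
  fixes p m a s :: nat
  assumes "prime p" "\<not> p dvd m"
    and "\<And>d. d dvd p ^ a * m \<Longrightarrow> in_ideal (int p ^ s) (cyclotomic d) f"
  shows "if s \<le> a then in_ideal (int p) (geo (p ^ (a - s) * m) (p ^ s)) f
         else in_ideal (int p) (monom 1 (p ^ a * m) - 1) f"
  using assms(3)
proof (induction a arbitrary: s f)
  have m: "m > 0" using assms(2) by (auto intro: Nat.gr0I)
  have cop: "coprime d p" if "d dvd m" for d
    using assms that by (meson coprime_commute dvd_trans prime_imp_coprime)
  \<comment> \<open>For s = 0 the generator is \<open>geo k 1\<close>, which is 1, so the ideal is
    the whole ring.\<close>
  have triv: "in_ideal (int p) (geo k (p ^ 0)) f" for k f
    by (rule in_idealI[where u = f and v = 0]) simp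
  have weak: "in_ideal (int p) g f" if "in_ideal (int p ^ Suc s) g f" for g f s
    using that unfolding in_ideal_def by (metis power_Suc smult_smult)
  {
    case (0 s f)
    show ?case
    proof (cases s)
      case 0
      then show ?thesis using triv by simp
    next
      case (Suc s')
      \<comment> \<open>When a = 0 all indices are prime to p, so the whole of X^m - 1 is collected
        at once.\<close>
      have "in_ideal (int p ^ s) (\<Prod>d | d dvd m. cyclotomic d) f"
      proof (rule in_ideal_prod)
        fix x y assume "x \<in> {d. d dvd m}" "y \<in> {d. d dvd m}" "x \<noteq> y"
        then show "coprime_at (int p) (cyclotomic x) (cyclotomic y)"
          using cyclotomic_coprime_at[of x y 1 p] m cop by (simp add: dvd_pos_nat)
      qed (use 0 m in auto)
      then show ?thesis using Suc weak m by (simp add: cyclotomic_prod)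
    qed
  next
    case (Suc a s f)
    show ?case
    proof (cases s)
      case 0
      then show ?thesis using triv by simp
    next
      case s: (Suc s')
      have p0: "p > 0" using assms(1) prime_gt_0_nat by blast
      define n' where "n' = p ^ a * m"
      have n': "n' > 0" using p0 m by (simp add: n'_def)
      have n: "n' * p = p ^ Suc a * m" by (simp add: n'_def)
      let ?S = "{D. D dvd n' * p \<and> \<not> D dvd n'}"
      \<comment> \<open>A divisor of n that does not divide n/p carries the full power of p, so all
        indices in this layer share one p-part.\<close>
      have S: "\<exists>d. D = p ^ Suc a * d \<and> d dvd m" if "D \<in> ?S" for D
      proof -
        have "D dvd p ^ Suc a * m" using that unfolding n by auto
        then obtain b c where bc: "D = b * c" "b dvd p ^ Suc a" "c dvd m"
          using division_decomp by blast
        then obtain i where i: "b = p ^ i" "i \<le> Suc a"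
          using assms(1) divides_primepow_nat by blast
        have "\<not> i \<le> a"
        proof
          assume "i \<le> a"
          then have "D dvd n'" unfolding n'_def bc(1) i(1) using bc(3) by (intro mult_dvd_mono le_imp_power_dvd)
          then show False using that by simp
        qed
        then have "i = Suc a" using i by simp
        then show ?thesis using bc i by blast
      qed
      have fin: "finite ?S" using n' p0 by (intro finite_subset[OF _ finite_divisors_nat[of "n' * p"]]) auto
      have "in_ideal (int p ^ s) (\<Prod>D\<in>?S. cyclotomic D) f"
      proof (rule in_ideal_prod[OF fin])
        fix x assume "x \<in> ?S"
        then show "in_ideal (int p ^ s) (cyclotomic x) f" using Suc.prems[of x] n by simp
      next
        fix x y assume xy: "x \<in> ?S" "y \<in> ?S" "x \<noteq> y"
        obtain d where d: "x = p ^ Suc a * d" "d dvd m" using S xy by blast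
        obtain d' where d': "y = p ^ Suc a * d'" "d' dvd m" using S xy by blast
        have "d > 0" "d' > 0" "d \<noteq> d'" "p ^ Suc a > 0" using d d' m p0 xy by (auto simp: dvd_pos_nat)
        then show "coprime_at (int p) (cyclotomic x) (cyclotomic y)"
          unfolding d(1) d'(1) using cop[OF d(2)] cop[OF d'(2)] by (intro cyclotomic_coprime_at)
      qed
      then have "in_ideal (int p ^ s) (geo n' p) f"
        using geo_cyclotomic[OF n' p0] by simp
      then obtain h k where f: "f = geo n' p * h + smult (int p ^ s) k" by (auto simp: in_ideal_def)
      obtain w where w: "geo n' p - [:int p:] = (monom 1 n' - 1) * w"
        using geo_cong by (meson dvdE)
      have "in_ideal (int p ^ s') (cyclotomic d) h" if d: "d dvd n'" for d
      proof (rule in_ideal_cancel)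
        have "d dvd p ^ Suc a * m" using d n by (metis dvd_mult2)
        then obtain x y where xy: "f = cyclotomic d * x + smult (int p ^ s) y"
          using Suc.prems[of d] by (auto simp: in_ideal_def)
        obtain r where r: "monom 1 n' - 1 = cyclotomic d * r" using cyclotomic_dvd[OF d n'] by auto
        have "smult (int p) h = [:int p:] * h" by simp
        also have "[:int p:] = geo n' p - cyclotomic d * r * w" using w r by (simp add: algebra_simps)
        also have "(geo n' p - cyclotomic d * r * w) * h = f - smult (int p ^ s) k - cyclotomic d * r * w * h"
          using f by (simp add: algebra_simps)
        also have "\<dots> = cyclotomic d * (x - r * w * h) + smult (int p ^ s) (y - k)"
          unfolding xy by (simp add: algebra_simps smult_diff_right)
        finally have "in_ideal (int p ^ s) (cyclotomic d) (smult (int p) h)" by (rule in_idealI)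
        then show "in_ideal (int p * int p ^ s') (cyclotomic d) (smult (int p) h)" using s by simp
        show "monic (cyclotomic d)" using d n' by (auto intro: monic_cyclotomic dvd_pos_nat)
        show "int p \<noteq> 0" using p0 by simp
      qed
      from Suc.IH[of s' h] this
      have IH: "if s' \<le> a then in_ideal (int p) (geo (p ^ (a - s') * m) (p ^ s')) h
         else in_ideal (int p) (monom 1 n' - 1) h" by (simp add: n'_def)
      \<comment> \<open>The error term p^s k is absorbed into the multiples of p because s is
        positive.\<close>
      have lift: "in_ideal (int p) (geo n' p * g) f" if gh: "in_ideal (int p) g h" for g
      proof -
        obtain u v where "h = g * u + smult (int p) v" using gh by (auto simp: in_ideal_def)
        then have "f = geo n' p * g * u + smult (int p) (geo n' p * v + smult (int p ^ s') k)"
          unfolding f s by (simp add: algebra_simps smult_add_right)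
        then show ?thesis by (rule in_idealI)
      qed
      show ?thesis
      proof (cases "s' \<le> a")
        case True
        \<comment> \<open>Since \<open>a - s'\<close> equals \<open>Suc a - s\<close>, the step
          keeps \<open>k\<close> and only lengthens the geometric sum from p^s' to p^s
          terms.\<close>
        define k where "k = p ^ (a - s') * m"
        have k: "k > 0" using p0 m by (simp add: k_def)
        have "n' = k * p ^ s'" unfolding n'_def k_def using True
          by (metis (no_types, lifting) le_add_diff_inverse2 mult.assoc mult.commute power_add)
        then have "geo n' p * geo k (p ^ s') = geo k (p ^ s)"
          using geo_geo[OF k, of "p ^ s'" p] s by (simp add: mult.commute)
        then show ?thesis using lift[of "geo k (p ^ s')"] IH True s by (simp add: k_def)
      next
        case False
        have "geo n' p * (monom 1 n' - 1) = monom 1 (p ^ Suc a * m) - 1"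
          using geo_mult[of n' p] n by (simp add: mult.commute)
        then show ?thesis using lift[of "monom 1 n' - 1"] IH False s by simp
      qed
    qed
  }
qed

section \<open>The kernel of the matrix modulo an integer\<close>

definition ker_mod :: "nat \<Rightarrow> int mat \<Rightarrow> int \<Rightarrow> int vec set" where
  "ker_mod n A N = {x \<in> carrier_vec n. \<forall>r<n. N dvd (A *\<^sub>v x) $ r}"

definition vec_poly :: "int vec \<Rightarrow> int poly" where
  "vec_poly x = (\<Sum>j<dim_vec x. monom (x $ j) j)"

lemma coeff_vec_poly: "coeff (vec_poly x) i = (if i < dim_vec x then x $ i else 0)"
  by (simp add: vec_poly_def coeff_sum)

text \<open>By Gauss's identity the totients of the divisors of n sum to n, so the row indices of
  \<open>A_mat\<close> match the entries of \<open>psi_rows\<close> exactly.\<close>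

lemma length_psi_rows: "n > 0 \<Longrightarrow> length (psi_rows n) = n"
proof -
  assume n: "n > 0"
  have "length (psi_rows n) = sum_list (map totient (filter (\<lambda>d. d dvd n) [1..<Suc n]))"
    by (simp add: psi_rows_def length_concat comp_def)
  also have "\<dots> = (\<Sum>d\<in>set (filter (\<lambda>d. d dvd n) [1..<Suc n]). totient d)"
    by (rule sum_list_distinct_conv_sum_set) simp
  also have "set (filter (\<lambda>d. d dvd n) [1..<Suc n]) = {d. d dvd n}"
    using n by (auto dest: dvd_imp_le simp: Suc_le_eq dvd_pos_nat)
  finally show ?thesis by (simp add: totient_divisor_sum)
qed

lemma set_psi_rows: "n > 0 \<Longrightarrow> set (psi_rows n) = {(d, i). d dvd n \<and> i < totient d}"
  by (auto simp: psi_rows_def image_iff less_Suc_eq_le Suc_le_eq dvd_pos_nat dvd_imp_le simp del: upt_Suc)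

lemma A_mat_mult_vec:
  assumes "n > 0" "x \<in> carrier_vec n" "r < n" "psi_rows n ! r = (d, i)"
  shows "(A_mat n *\<^sub>v x) $ r = coeff (\<Sum>j<n. smult (x $ j) (pseudo_mod (monom 1 j) (cyclotomic d))) i"
  using assms
  by (auto simp: A_mat_def scalar_prod_def coeff_sum atLeast0LessThan mult.commute intro!: sum.cong)

text \<open>The block of A x belonging to d lists the coefficients of \<open>R d\<close>, the
  remainder of \<open>vec_poly x\<close> modulo the d-th cyclotomic polynomial. That remainder lies
  in the ideal exactly when \<open>N\<close> divides its coefficients.\<close>

lemma ker_mod_A_mat_iff:
  assumes n: "n > 0" and x: "x \<in> carrier_vec n"
  shows "x \<in> ker_mod n (A_mat n) N \<longleftrightarrow> (\<forall>d. d dvd n \<longrightarrow> in_ideal N (cyclotomic d) (vec_poly x))"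
proof -
  define R where "R = (\<lambda>d. \<Sum>j<n. smult (x $ j) (pseudo_mod (monom 1 j) (cyclotomic d)))"
  have R_dvd: "cyclotomic d dvd vec_poly x - R d" if "d dvd n" for d
  proof -
    have "monic (cyclotomic d)" using that n monic_cyclotomic dvd_pos_nat by blast
    then have *: "cyclotomic d dvd monom 1 j - pseudo_mod (monom 1 j) (cyclotomic d)" for j
      by (rule pseudo_mod_monic)
    have "vec_poly x - R d = (\<Sum>j<n. smult (x $ j) (monom 1 j - pseudo_mod (monom 1 j) (cyclotomic d)))"
      using x by (simp add: vec_poly_def R_def sum_subtractf smult_diff_right smult_monom)
    also have "cyclotomic d dvd \<dots>" using * by (intro dvd_sum dvd_smult)
    finally show ?thesis .
  qed
  have R_deg: "degree (R d) < degree (cyclotomic d)" if "d dvd n" for d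
  proof -
    have d: "d > 0" using that n dvd_pos_nat by blast
    then have t: "degree (cyclotomic d) > 0" by (simp add: degree_cyclotomic)
    show ?thesis unfolding R_def
    proof (rule degree_sum_less[OF _ t])
      fix j
      show "degree (smult (x $ j) (pseudo_mod (monom 1 j) (cyclotomic d))) < degree (cyclotomic d)"
        using pseudo_mod_monic(2)[OF monic_cyclotomic[OF d], of "monom 1 j"] t by auto
    qed
  qed
  show ?thesis
  proof
    assume ker: "x \<in> ker_mod n (A_mat n) N"
    show "\<forall>d. d dvd n \<longrightarrow> in_ideal N (cyclotomic d) (vec_poly x)"
    proof (intro allI impI)
      fix d assume d: "d dvd n"
      have "N dvd coeff (R d) i" for i
      proof (cases "i < totient d")
        case True
        then have "(d, i) \<in> set (psi_rows n)" using d n by (simp add: set_psi_rows)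
        then obtain r where "r < n" "psi_rows n ! r = (d, i)"
          by (metis in_set_conv_nth length_psi_rows n)
        then show ?thesis using A_mat_mult_vec[OF n x, of r d i] ker by (auto simp: ker_mod_def R_def)
      next
        case False
        then have "coeff (R d) i = 0"
          using R_deg[OF d] degree_cyclotomic[of d] d n by (intro coeff_eq_0) (auto simp: dvd_pos_nat)
        then show ?thesis by simp
      qed
      then have "[:N:] dvd R d" by (simp add: const_poly_dvd_iff)
      then obtain w where w: "R d = [:N:] * w" by auto
      obtain u where u: "vec_poly x - R d = cyclotomic d * u" using R_dvd[OF d] by auto
      have "vec_poly x = cyclotomic d * u + smult N w" using w u by (simp add: algebra_simps)
      then show "in_ideal N (cyclotomic d) (vec_poly x)" by (rule in_idealI)
    qed
  next
    assume all: "\<forall>d. d dvd n \<longrightarrow> in_ideal N (cyclotomic d) (vec_poly x)"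
    have "N dvd (A_mat n *\<^sub>v x) $ r" if r: "r < n" for r
    proof -
      obtain d i where di: "psi_rows n ! r = (d, i)" by force
      then have "(d, i) \<in> set (psi_rows n)" using r n by (metis length_psi_rows nth_mem)
      then have d: "d dvd n" using n by (simp add: set_psi_rows)
      obtain u v where uv: "vec_poly x = cyclotomic d * u + smult N v" using all d by (auto simp: in_ideal_def)
      obtain u' where u': "vec_poly x - R d = cyclotomic d * u'" using R_dvd[OF d] by auto
      have "R d = cyclotomic d * (u - u') + smult N v" using uv u' by (simp add: algebra_simps)
      then have "in_ideal N (cyclotomic d) (R d)" by (rule in_idealI)
      then obtain w where "R d = smult N w"
        using in_ideal_degree_less R_deg[OF d] monic_cyclotomic d n dvd_pos_nat by blast
      then show ?thesis using A_mat_mult_vec[OF n x r di] by (simp add: R_def)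
    qed
    then show "x \<in> ker_mod n (A_mat n) N" using x by (simp add: ker_mod_def)
  qed
qed

section \<open>Kernel vectors as periodic vectors\<close>

text \<open>The product places q copies of \<open>r\<close> side by side at distance k; the degree
  bound keeps them from overlapping.\<close>

lemma coeff_geo_mult:
  assumes "r = 0 \<or> degree r < k" "k > 0"
  shows "coeff (geo k q * r) i = (if i < k * q then coeff r (i mod k) else 0)"
proof -
  have "coeff (geo k q * r) i = (\<Sum>j<q. coeff (monom 1 (k * j) * r) i)"
    by (simp add: geo_def sum_distrib_right coeff_sum)
  also have "\<dots> = (\<Sum>j<q. if j = i div k then coeff r (i mod k) else 0)"
  proof (rule sum.cong[OF refl])
    fix j
    consider "j = i div k" | "j < i div k" | "j > i div k" by linarith
    then show "coeff (monom 1 (k * j) * r) i = (if j = i div k then coeff r (i mod k) else 0)"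
    proof cases
      case 1
      then show ?thesis by (simp add: coeff_monom_mult minus_mult_div_eq_mod)
    next
      case 2
      then have "k * Suc j \<le> k * (i div k)" by (intro mult_le_mono2) simp
      also have "\<dots> \<le> i" by simp
      finally have "k \<le> i - k * j" by simp
      then have "coeff r (i - k * j) = 0" using assms(1) by (auto intro: coeff_eq_0)
      then show ?thesis using 2 by (simp add: coeff_monom_mult)
    next
      case 3
      then have "i < k * j" using assms(2) by (simp add: div_less_iff_less_mult mult.commute)
      then show ?thesis using 3 by (simp add: coeff_monom_mult)
    qed
  qed
  also have "\<dots> = (if i < k * q then coeff r (i mod k) else 0)"
    using assms(2) by (auto simp: div_less_iff_less_mult mult.commute)
  finally show ?thesis .
qed

lemma degree_vec_poly_less: "x \<in> carrier_vec n \<Longrightarrow> n > 0 \<Longrightarrow> degree (vec_poly x) < n"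
  unfolding vec_poly_def by (intro degree_sum_less) (auto intro: le_less_trans[OF degree_monom_le])

text \<open>Modulo p the polynomial of \<open>x\<close> is a multiple of
  \<open>geo k (p ^ s)\<close>. Reducing the cofactor modulo X^k - 1 changes the product only by a
  multiple of X^n - 1; then both sides have degree below n, so they agree modulo p coefficient by
  coefficient, and the product is k-periodic.\<close>

lemma ker_mod_imp_periodic:
  fixes p m a s :: nat
  assumes "prime p" "\<not> p dvd m" "s \<le> a" "n = p ^ a * m"
    and x: "x \<in> ker_mod n (A_mat n) (int p ^ s)" and i: "i < n"
  shows "int p dvd x $ i - x $ (i mod (p ^ (a - s) * m))"
proof -
  define k where "k = p ^ (a - s) * m"
  have m: "m > 0" using assms(2) by (auto intro: Nat.gr0I)
  have p0: "p > 0" using assms(1) prime_gt_0_nat by blast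
  have k: "k > 0" using p0 m by (simp add: k_def)
  have n: "n > 0" using p0 m assms(4) by simp
  have nk: "n = k * p ^ s" unfolding assms(4) k_def using assms(3)
    by (metis (no_types, lifting) le_add_diff_inverse2 mult.assoc mult.commute power_add)
  have xc: "x \<in> carrier_vec n" using x by (simp add: ker_mod_def)
  have "in_ideal (int p) (geo k (p ^ s)) (vec_poly x)"
    using all_cyclotomic_in_ideal_imp[OF assms(1,2), of a s "vec_poly x"] x ker_mod_A_mat_iff[OF n xc] assms(3,4)
    by (simp add: k_def)
  then obtain u v where uv: "vec_poly x = geo k (p ^ s) * u + smult (int p) v" by (auto simp: in_ideal_def)
  obtain t r where tr: "u = (monom 1 k - 1) * t + r" "r = 0 \<or> degree r < degree (monom 1 k - 1 :: int poly)"
    using monic_division[OF monic_monom_diff_1[OF k]] by blast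
  have r: "r = 0 \<or> degree r < k" using tr(2) by (simp add: degree_monom_diff_1[OF k])
  have "vec_poly x - geo k (p ^ s) * r = (monom 1 k - 1) * geo k (p ^ s) * t + smult (int p) v"
    unfolding uv tr(1) by (simp add: algebra_simps)
  then have *: "in_ideal (int p) (monom 1 n - 1) (vec_poly x - geo k (p ^ s) * r)"
    unfolding geo_mult nk by (rule in_idealI)
  have "degree (geo k (p ^ s) * r) < n"
    using n by (intro degree_lessI) (auto simp: coeff_geo_mult[OF r k] nk)
  then have "degree (vec_poly x - geo k (p ^ s) * r) < degree (monom 1 n - 1 :: int poly)"
    using degree_vec_poly_less[OF xc n] unfolding degree_monom_diff_1[OF n] by (intro degree_diff_less)
  then obtain w where w: "vec_poly x - geo k (p ^ s) * r = smult (int p) w"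
    using in_ideal_degree_less[OF * monic_monom_diff_1[OF n]] by blast
  have "x $ j - coeff r (j mod k) = int p * coeff w j" if "j < n" for j
    using arg_cong[OF w, of "\<lambda>f. coeff f j"] that xc coeff_geo_mult[OF r k] nk by (simp add: coeff_vec_poly)
  moreover have "i mod k < n" using i by (meson le_less_trans mod_less_eq_dividend)
  ultimately have "x $ i - coeff r (i mod k) = int p * coeff w i"
    "x $ (i mod k) - coeff r (i mod k mod k) = int p * coeff w (i mod k)" using i by blast+
  then have "x $ i - x $ (i mod k) = int p * (coeff w i - coeff w (i mod k))"
    by (simp add: algebra_simps)
  then show ?thesis unfolding k_def by (metis dvd_triv_left)
qed

text \<open>Beyond s = a the generator is X^n - 1 itself, whose degree exceeds that of
  \<open>vec_poly x\<close>.\<close>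

lemma ker_mod_imp_zero:
  fixes p m a s :: nat
  assumes "prime p" "\<not> p dvd m" "a < s" "n = p ^ a * m"
    and x: "x \<in> ker_mod n (A_mat n) (int p ^ s)" and i: "i < n"
  shows "int p dvd x $ i"
proof -
  have n: "n > 0" using i by simp
  have xc: "x \<in> carrier_vec n" using x by (simp add: ker_mod_def)
  have "in_ideal (int p) (monom 1 n - 1) (vec_poly x)"
    using all_cyclotomic_in_ideal_imp[OF assms(1,2), of a s "vec_poly x"] x ker_mod_A_mat_iff[OF n xc] assms(3,4)
    by simp
  then obtain w where "vec_poly x = smult (int p) w"
    using in_ideal_degree_less monic_monom_diff_1[OF n] degree_vec_poly_less[OF xc n] degree_monom_diff_1[OF n]
    by metis
  then have "coeff (vec_poly x) i = int p * coeff w i" by simp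
  then show ?thesis using xc i by (simp add: coeff_vec_poly)
qed

text \<open>A periodic vector is \<open>geo k q\<close> times its first period. Modulo the d-th
  cyclotomic polynomial, \<open>geo k q\<close> is q if d divides k and 0 for the other d. Thus a
  periodic vector lies in the kernel itself, without changing the lift.\<close>

lemma periodic_imp_ker_mod:
  assumes "k > 0" "q > 0" "n = k * q" and x: "x \<in> carrier_vec n"
    and per: "\<And>i. i < n \<Longrightarrow> x $ (i mod k) = x $ i"
  shows "x \<in> ker_mod n (A_mat n) (int q)"
proof -
  have n: "n > 0" using assms by simp
  define r where "r = (\<Sum>i<k. monom (x $ i) i)"
  have r: "degree r < k" unfolding r_def
    using assms(1) by (intro degree_sum_less) (auto intro: le_less_trans[OF degree_monom_le])
  have cr: "coeff r i = x $ i" if "i < k" for i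
    using that by (simp add: r_def coeff_sum)
  have eq: "vec_poly x = geo k q * r"
  proof (rule poly_eqI)
    fix i
    show "coeff (vec_poly x) i = coeff (geo k q * r) i"
      using coeff_geo_mult[of r k q i] r cr[of "i mod k"] assms(1,3) x per[of i] by (simp add: coeff_vec_poly)
  qed
  have "in_ideal (int q) (cyclotomic d) (vec_poly x)" if d: "d dvd n" for d
  proof (cases "d dvd k")
    case True
    obtain w where w: "geo k q - [:int q:] = (monom 1 k - 1) * w" using geo_cong by (meson dvdE)
    obtain t where t: "monom 1 k - 1 = cyclotomic d * t" using cyclotomic_dvd[OF True assms(1)] by auto
    have "geo k q = cyclotomic d * t * w + [:int q:]" using w t by (simp add: algebra_simps)
    then have "vec_poly x = cyclotomic d * (t * w * r) + smult (int q) r"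
      unfolding eq by (simp add: algebra_simps)
    then show ?thesis by (rule in_idealI)
  next
    case False
    have "cyclotomic d dvd geo k q"
      using assms(1-3) d False by (subst geo_cyclotomic) (auto intro!: dvd_prodI)
    then obtain t where "geo k q = cyclotomic d * t" by auto
    then have "vec_poly x = cyclotomic d * (t * r) + smult (int q) 0" using eq by simp
    then show ?thesis by (rule in_idealI)
  qed
  then show ?thesis using ker_mod_A_mat_iff[OF n x] by blast
qed

section \<open>Counting kernel vectors reduced modulo a prime\<close>

abbreviation red :: "nat \<Rightarrow> int vec \<Rightarrow> int vec" where
  "red p \<equiv> map_vec (\<lambda>z. z mod int p)"

lemma red_red: "red p (red p x) = red p x"
  by (auto intro!: eq_vecI)

lemma card_vec_choices:
  assumes "\<And>i. i < n \<Longrightarrow> finite (B i)"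
  shows "card {v \<in> carrier_vec n. \<forall>i<n. v $ i \<in> B i} = (\<Prod>i<n. card (B i))"
proof -
  have "bij_betw (vec n) (PiE {..<n} B) {v \<in> carrier_vec n. \<forall>i<n. v $ i \<in> B i}"
  proof (rule bij_betw_byWitness[where f' = "\<lambda>v. restrict (\<lambda>i. v $ i) {..<n}"])
    show "\<forall>f\<in>PiE {..<n} B. restrict (\<lambda>i. vec n f $ i) {..<n} = f"
      by (auto intro!: ext simp: restrict_def PiE_def extensional_def)
    show "\<forall>v\<in>{v \<in> carrier_vec n. \<forall>i<n. v $ i \<in> B i}. vec n (restrict (\<lambda>i. v $ i) {..<n}) = v"
      by (auto intro!: eq_vecI)
  qed (auto simp: PiE_def)
  from bij_betw_same_card[OF this] show ?thesis by (simp add: card_PiE)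
qed

lemma mult_mat_vec_dvd:
  fixes M :: "int mat"
  assumes "M \<in> carrier_mat n n" "w \<in> carrier_vec n" "\<And>i. i < n \<Longrightarrow> N dvd w $ i" "i < n"
  shows "N dvd (M *\<^sub>v w) $ i"
  using assms by (auto simp: scalar_prod_def intro!: dvd_sum)

lemma red_eq_iff:
  assumes "x \<in> carrier_vec n" "y \<in> carrier_vec n"
  shows "red p x = red p y \<longleftrightarrow> (\<forall>i<n. int p dvd x $ i - y $ i)"
  using assms by (auto simp: vec_eq_iff mod_eq_dvd_iff)

lemma red_mult_mat_vec:
  assumes M: "M \<in> carrier_mat n n" and y: "y \<in> carrier_vec n"
  shows "red p (M *\<^sub>v red p y) = red p (M *\<^sub>v y)"
proof -
  have "int p dvd (M *\<^sub>v red p y) $ i - (M *\<^sub>v y) $ i" if i: "i < n" for i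
  proof -
    have "int p dvd (M *\<^sub>v (red p y - y)) $ i"
      by (rule mult_mat_vec_dvd[OF M _ _ i]) (use y in \<open>auto simp: minus_mod_eq_mult_div[symmetric] mod_eq_dvd_iff[symmetric]\<close>)
    also have "M *\<^sub>v (red p y - y) = M *\<^sub>v red p y - M *\<^sub>v y"
      using M y by (intro mult_minus_distrib_mat_vec) auto
    finally show ?thesis using i M by simp
  qed
  then show ?thesis using M y by (subst red_eq_iff[of _ n]) auto
qed

text \<open>The determinant is its own inverse, so the adjugate scaled by it is an integral
  inverse.\<close>

lemma unimodular_inverse:
  assumes "unimodular n Q"
  obtains Q' where "Q' \<in> carrier_mat n n" "Q * Q' = 1\<^sub>m n" "Q' * Q = 1\<^sub>m n"
proof -
  have Q: "Q \<in> carrier_mat n n" and d: "det Q * det Q = 1" using assms by (auto simp: unimodular_def)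
  have "Q * (det Q \<cdot>\<^sub>m adj_mat Q) = 1\<^sub>m n"
    using mult_smult_distrib[OF Q adj_mat(1)[OF Q]] adj_mat[OF Q] d by (auto intro!: eq_matI)
  moreover have "(det Q \<cdot>\<^sub>m adj_mat Q) * Q = 1\<^sub>m n"
    using mult_smult_assoc_mat[OF adj_mat(1)[OF Q] Q] adj_mat[OF Q] d by (auto intro!: eq_matI)
  ultimately show ?thesis using adj_mat(1)[OF Q] by (intro that) auto
qed

text \<open>Multiplication by \<open>P\<close> preserves divisibility of all entries by p^s, and
  \<open>Q\<close> and its inverse act as mutually inverse maps on vectors reduced modulo p. So the
  count is that of the diagonal matrix: a coordinate contributes p residues if p^s divides its
  diagonal entry and one residue otherwise.\<close>

lemma card_red_ker_mod_smith:
  fixes p s :: nat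
  assumes "prime p" "s > 0" and A: "A \<in> carrier_mat n n"
    and P: "unimodular n P" and Q: "unimodular n Q"
    and D: "P * A * Q = mat n n (\<lambda>(i, j). if i = j then e i else 0)"
  shows "card (red p ` ker_mod n A (int p ^ s)) = p ^ card {j. j < n \<and> int p ^ s dvd e j}"
proof -
  let ?N = "int p ^ s" and ?D = "mat n n (\<lambda>(i, j). if i = j then e i else 0)"
  have p0: "p > 0" using assms(1) prime_gt_0_nat by blast
  have Pc: "P \<in> carrier_mat n n" and Qc: "Q \<in> carrier_mat n n" using P Q by (auto simp: unimodular_def)
  obtain P' where P': "P' \<in> carrier_mat n n" "P * P' = 1\<^sub>m n" "P' * P = 1\<^sub>m n"
    using unimodular_inverse[OF P] by blast
  obtain Q' where Q': "Q' \<in> carrier_mat n n" "Q * Q' = 1\<^sub>m n" "Q' * Q = 1\<^sub>m n"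
    using unimodular_inverse[OF Q] by blast
  have Q'Q: "Q' *\<^sub>v (Q *\<^sub>v y) = y" if "y \<in> carrier_vec n" for y
    using that Q' Qc by (simp add: assoc_mult_mat_vec[symmetric])
  have QQ': "Q *\<^sub>v (Q' *\<^sub>v y) = y" if "y \<in> carrier_vec n" for y
    using that Q' Qc by (simp add: assoc_mult_mat_vec[symmetric])
  define K where "K = {y \<in> carrier_vec n. \<forall>j<n. ?N dvd e j * y $ j}"
  have Dy: "(?D *\<^sub>v y) $ j = e j * y $ j" if "y \<in> carrier_vec n" "j < n" for y j
  proof -
    have "(?D *\<^sub>v y) $ j = (\<Sum>i<n. (if j = i then e j else 0) * y $ i)"
      using that by (simp add: scalar_prod_def atLeast0LessThan)
    also have "\<dots> = (\<Sum>i<n. if j = i then e j * y $ i else 0)" by (intro sum.cong) auto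
    also have "\<dots> = e j * y $ j" using that by simp
    finally show ?thesis .
  qed
  have Dmult: "?D *\<^sub>v y = P *\<^sub>v (A *\<^sub>v (Q *\<^sub>v y))" if "y \<in> carrier_vec n" for y
    using that Pc A Qc unfolding D[symmetric] by (simp add: assoc_mult_mat_vec[of _ n n _ n])
  have QK: "Q *\<^sub>v y \<in> ker_mod n A ?N \<longleftrightarrow> y \<in> K" if y: "y \<in> carrier_vec n" for y
  proof -
    define w where "w = A *\<^sub>v (Q *\<^sub>v y)"
    have w: "w \<in> carrier_vec n" using A Qc y by (simp add: w_def)
    have "P' *\<^sub>v (P *\<^sub>v w) = w" using w P' Pc by (simp add: assoc_mult_mat_vec[symmetric])
    then have "(\<forall>r<n. ?N dvd w $ r) \<longleftrightarrow> (\<forall>r<n. ?N dvd (P *\<^sub>v w) $ r)"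
      using mult_mat_vec_dvd[OF Pc w, of ?N] mult_mat_vec_dvd[OF P'(1), of "P *\<^sub>v w" ?N] Pc w by auto
    also have "P *\<^sub>v w = ?D *\<^sub>v y" using Dmult[OF y] by (simp add: w_def)
    finally show ?thesis using y Qc Dy[OF y] by (auto simp: ker_mod_def K_def w_def)
  qed
  have "bij_betw (\<lambda>y. red p (Q *\<^sub>v y)) (red p ` K) (red p ` ker_mod n A ?N)"
  proof (rule bij_betw_byWitness[where f' = "\<lambda>x. red p (Q' *\<^sub>v x)"])
    show "\<forall>a\<in>red p ` K. red p (Q' *\<^sub>v red p (Q *\<^sub>v a)) = a"
      using Qc Q'(1) by (auto simp: K_def red_mult_mat_vec Q'Q red_red)
    show "\<forall>a\<in>red p ` ker_mod n A ?N. red p (Q *\<^sub>v red p (Q' *\<^sub>v a)) = a"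
      using Qc Q'(1) by (auto simp: ker_mod_def red_mult_mat_vec QQ' red_red)
    show "(\<lambda>y. red p (Q *\<^sub>v y)) ` red p ` K \<subseteq> red p ` ker_mod n A ?N"
    proof clarify
      fix y assume y: "y \<in> K"
      then have yc: "y \<in> carrier_vec n" by (simp add: K_def)
      then show "red p (Q *\<^sub>v red p y) \<in> red p ` ker_mod n A ?N"
        using y QK[OF yc] red_mult_mat_vec[OF Qc yc] by auto
    qed
    show "(\<lambda>x. red p (Q' *\<^sub>v x)) ` red p ` ker_mod n A ?N \<subseteq> red p ` K"
    proof clarify
      fix x assume x: "x \<in> ker_mod n A ?N"
      then have xc: "x \<in> carrier_vec n" by (simp add: ker_mod_def)
      then have "Q' *\<^sub>v x \<in> K" using x QK[of "Q' *\<^sub>v x"] QQ'[OF xc] Q'(1) by simp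
      then show "red p (Q' *\<^sub>v red p x) \<in> red p ` K" using red_mult_mat_vec[OF Q'(1) xc] by auto
    qed
  qed
  then have "card (red p ` ker_mod n A ?N) = card (red p ` K)" by (rule bij_betw_same_card[symmetric])
  also have "red p ` K = {v \<in> carrier_vec n. \<forall>j<n. v $ j \<in> (if ?N dvd e j then {0..<int p} else {0})}" (is "_ = ?V")
  proof (intro equalityI subsetI)
    fix v assume "v \<in> red p ` K"
    then obtain y where y: "v = red p y" "y \<in> carrier_vec n" "\<And>j. j < n \<Longrightarrow> ?N dvd e j * y $ j"
      by (auto simp: K_def)
    have "v $ j \<in> (if ?N dvd e j then {0..<int p} else {0})" if j: "j < n" for j
    proof (cases "?N dvd e j")
      case True
      then show ?thesis using y j p0 by simp
    next
      case False
      \<comment> \<open>If p did not divide this coordinate, the whole of p^s would have to divide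
        \<open>e j\<close>.\<close>
      have "int p dvd y $ j"
      proof (rule ccontr)
        assume "\<not> int p dvd y $ j"
        then have "coprime (int p) (y $ j)" using assms(1) by (intro prime_imp_coprime) auto
        then have "?N dvd e j" using y(3)[OF j] coprime_dvd_mult_left_iff by (metis coprime_power_left_iff)
        then show False using False by simp
      qed
      then show ?thesis using y j False by simp
    qed
    then show "v \<in> ?V" using y by simp
  next
    fix v assume v: "v \<in> ?V"
    \<comment> \<open>The reduced vector is its own lift: its coordinates vanish wherever p^s does
      not divide the diagonal entry.\<close>
    have "v \<in> K" using v by (auto simp: K_def split: if_splits)
    moreover have "red p v = v" using v p0 by (auto intro!: eq_vecI split: if_splits)
    ultimately show "v \<in> red p ` K" by (metis imageI)
  qed
  also have "card ?V = (\<Prod>j<n. if ?N dvd e j then p else 1)"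
    by (subst card_vec_choices) (auto intro!: prod.cong)
  also have "\<dots> = p ^ card {j. j < n \<and> ?N dvd e j}"
    by (simp add: prod.If_cases lessThan_def Int_def)
  finally show ?thesis .
qed

lemma card_red_periodic:
  assumes "0 < k" "k \<le> n" "p > 0"
  shows "card {v \<in> carrier_vec n. \<forall>i<n. v $ i \<in> {0..<int p} \<and> v $ (i mod k) = v $ i} = p ^ k"
proof -
  let ?W = "{w \<in> carrier_vec k. \<forall>i<k. w $ i \<in> {0..<int p}}"
  let ?V = "{v \<in> carrier_vec n. \<forall>i<n. v $ i \<in> {0..<int p} \<and> v $ (i mod k) = v $ i}"
  have "bij_betw (\<lambda>w. vec n (\<lambda>i. w $ (i mod k))) ?W ?V"
  proof (rule bij_betw_byWitness[where f' = "\<lambda>v. vec k (\<lambda>i. v $ i)"])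
    show "\<forall>v\<in>?V. vec n (\<lambda>i. vec k (\<lambda>i. v $ i) $ (i mod k)) = v"
      using assms by (auto intro!: eq_vecI)
    have "i mod k < n" for i using assms mod_less_divisor[of k i] by linarith
    then show "(\<lambda>w. vec n (\<lambda>i. w $ (i mod k))) ` ?W \<subseteq> ?V" using assms by auto
  qed (use assms in \<open>auto intro!: eq_vecI\<close>)
  then have "card ?V = card ?W" by (rule bij_betw_same_card[symmetric])
  also have "\<dots> = p ^ k" by (subst card_vec_choices) auto
  finally show ?thesis .
qed

lemma card_smith_diag_dvd:
  fixes p m a s :: nat
  assumes sm: "is_smith_diag n (A_mat n) e" and p: "prime p" "\<not> p dvd m" "n = p ^ a * m" and s: "s > 0"
  shows "card {j. j < n \<and> int p ^ s dvd e j} = (if s \<le> a then p ^ (a - s) * m else 0)"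
proof -
  have m: "m > 0" using p(2) by (auto intro: Nat.gr0I)
  have p0: "p > 0" using p(1) prime_gt_0_nat by blast
  let ?K = "ker_mod n (A_mat n) (int p ^ s)"
  obtain P Q where "unimodular n P" "unimodular n Q"
    "P * A_mat n * Q = mat n n (\<lambda>(i, j). if i = j then e i else 0)"
    using sm by (auto simp: is_smith_diag_def)
  then have *: "card (red p ` ?K) = p ^ card {j. j < n \<and> int p ^ s dvd e j}"
    using p(1) s by (intro card_red_ker_mod_smith) (auto simp: A_mat_def)
  have "card (red p ` ?K) = p ^ (if s \<le> a then p ^ (a - s) * m else 0)"
  proof (cases "s \<le> a")
    case True
    define k where "k = p ^ (a - s) * m"
    have k: "k > 0" using p0 m by (simp add: k_def)
    have nk: "n = k * p ^ s" unfolding p(3) k_def using True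
      by (metis (no_types, lifting) le_add_diff_inverse2 mult.assoc mult.commute power_add)
    have kn: "k \<le> n" using nk p0 by simp
    have "red p ` ?K = {v \<in> carrier_vec n. \<forall>i<n. v $ i \<in> {0..<int p} \<and> v $ (i mod k) = v $ i}" (is "_ = ?V")
    proof (intro equalityI subsetI)
      fix v assume "v \<in> red p ` ?K"
      then obtain x where x: "v = red p x" "x \<in> ?K" by auto
      have xc: "x \<in> carrier_vec n" using x by (simp add: ker_mod_def)
      have "x $ (i mod k) mod int p = x $ i mod int p" if "i < n" for i
        using ker_mod_imp_periodic[OF p(1,2) True p(3) x(2) that] by (metis k_def mod_eq_dvd_iff)
      moreover have "i mod k < n" if "i < n" for i using that by (meson le_less_trans mod_less_eq_dividend)
      ultimately show "v \<in> ?V" using x(1) xc p0 by simp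
    next
      fix v assume v: "v \<in> ?V"
      then have "v \<in> ?K"
        using periodic_imp_ker_mod[OF k _ nk, of v] p0 by simp
      moreover have "red p v = v" using v by (auto intro!: eq_vecI)
      ultimately show "v \<in> red p ` ?K" by (metis imageI)
    qed
    then show ?thesis using card_red_periodic[OF k kn p0] True by (simp add: k_def)
  next
    case False
    have "red p ` ?K = {0\<^sub>v n}"
    proof (intro equalityI subsetI)
      fix v assume "v \<in> red p ` ?K"
      then obtain x where x: "v = red p x" "x \<in> ?K" by auto
      have "x \<in> carrier_vec n" using x by (simp add: ker_mod_def)
      then show "v \<in> {0\<^sub>v n}"
        using ker_mod_imp_zero[OF p(1,2) _ p(3) x(2)] False x(1) by (auto intro!: eq_vecI)
    next
      fix v :: "int vec" assume "v \<in> {0\<^sub>v n}"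
      moreover have "0\<^sub>v n \<in> ?K"
        by (auto simp: ker_mod_def A_mat_def scalar_prod_def)
      moreover have "red p (0\<^sub>v n) = 0\<^sub>v n" by (auto intro!: eq_vecI)
      ultimately show "v \<in> red p ` ?K" by (metis imageI singletonD)
    qed
    then show ?thesis using False by simp
  qed
  with * have "p ^ card {j. j < n \<and> int p ^ s dvd e j} = p ^ (if s \<le> a then p ^ (a - s) * m else 0)" by simp
  then show ?thesis using prime_gt_1_nat[OF p(1)] by (simp only: power_inject_exp)
qed

section \<open>The successive quotients of the elementary divisors\<close>

text \<open>An up-closed subset of an initial segment is a final piece of it, hence determined by
  its size.\<close>

lemma up_closed_mem_iff:
  fixes J :: "nat set"
  assumes "J \<subseteq> {..<n}" "\<And>i j. i \<in> J \<Longrightarrow> i \<le> j \<Longrightarrow> j < n \<Longrightarrow> j \<in> J" "j < n"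
  shows "j \<in> J \<longleftrightarrow> n - card J \<le> j"
proof
  have fin: "finite J" using assms(1) finite_subset by blast
  assume "j \<in> J"
  then have "{j..<n} \<subseteq> J" using assms(2) by auto
  then have "n - j \<le> card J" using card_mono[OF fin, of "{j..<n}"] by simp
  then show "n - card J \<le> j" by linarith
next
  assume le: "n - card J \<le> j"
  show "j \<in> J"
  proof (rule ccontr)
    assume "j \<notin> J"
    then have "J \<subseteq> {Suc j..<n}" using assms by (metis atLeastLessThan_iff lessThan_iff not_less_eq_eq subset_iff)
    then have "card J \<le> n - Suc j" using card_mono[of "{Suc j..<n}" J] by simp
    then show False using le assms(3) by linarith
  qed
qed

lemma smith_diag_dvd_mono:
  assumes "is_smith_diag n A e" "i \<le> j" "j < n"
  shows "e i dvd e j"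
  using assms(2,3)
proof (induction j rule: dec_induct)
  case (step j)
  then show ?case using assms(1) unfolding is_smith_diag_def by (meson Suc_lessD dvd_trans)
qed simp

lemma prime_power_dvd_smith_diag_iff:
  assumes sm: "is_smith_diag n (A_mat n) e" and p: "prime p" and s: "s > 0" and j: "j < n"
  shows "int p ^ s dvd e j \<longleftrightarrow> s \<le> multiplicity p n \<and> n - n div p ^ s \<le> j"
proof -
  define a where "a = multiplicity p n"
  have n: "n > 0" using j by simp
  obtain m where m: "n = p ^ a * m" "\<not> p dvd m"
    unfolding a_def using multiplicity_decompose'[of n p] n p not_prime_unit[of p] by (metis not_gr0)
  let ?J = "{j. j < n \<and> int p ^ s dvd e j}"
  have card: "card ?J = (if s \<le> a then p ^ (a - s) * m else 0)"
    by (rule card_smith_diag_dvd[OF sm p m(2,1) s])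
  have "j \<in> ?J \<longleftrightarrow> n - card ?J \<le> j"
    using smith_diag_dvd_mono[OF sm] j by (intro up_closed_mem_iff) (auto intro: dvd_trans)
  moreover have "n div p ^ s = p ^ (a - s) * m" if "s \<le> a"
  proof -
    have "n = p ^ s * (p ^ (a - s) * m)" using that m(1) by (metis le_add_diff_inverse mult.assoc power_add)
    then show ?thesis using prime_gt_0_nat[OF p] by simp
  qed
  \<comment> \<open>For s above the multiplicity the count is 0, and n \<le> j contradicts j <
    n.\<close>
  ultimately show ?thesis using card j by (auto simp: a_def[symmetric] not_le)
qed

text \<open>Zero would be divisible by every power of 2, whereas powers beyond the multiplicity of 2
  in n divide no entry. The prime 2 is an arbitrary choice.\<close>

lemma smith_diag_pos:
  assumes "is_smith_diag n (A_mat n) e" "j < n"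
  shows "e j > 0"
proof -
  have "\<not> int 2 ^ Suc (multiplicity 2 n) dvd e j"
    using prime_power_dvd_smith_diag_iff[OF assms(1) two_is_prime_nat zero_less_Suc assms(2)] by fastforce
  then have "e j \<noteq> 0" by auto
  then show ?thesis using assms by (auto simp: is_smith_diag_def less_le)
qed

section \<open>Positions at which a prime enters the chain\<close>

text \<open>Positions are counted from 1: p^t divides exactly the last n/p^t elementary divisors,
  and the first of these stands at n - n/p^t + 1.\<close>

definition jumps :: "nat \<Rightarrow> nat \<Rightarrow> nat \<Rightarrow> nat set" where
  "jumps n p j = {t. 1 \<le> t \<and> t \<le> multiplicity p n \<and> j = n - n div p ^ t + 1}"

text \<open>The position determines n/p^t, hence p^t, hence both p and t. So no two primes, and no
  two powers of one prime, enter at the same place.\<close>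

lemma jumps_unique:
  assumes "n > 0" "prime p" "prime q" "t \<in> jumps n p j" "u \<in> jumps n q j"
  shows "p = q" "t = u"
proof -
  \<comment> \<open>These bounds let truncated subtraction from n be cancelled.\<close>
  have "n div p ^ t \<le> n" "n div q ^ u \<le> n" by simp_all
  moreover have "n - n div p ^ t = n - n div q ^ u" using assms(4,5) unfolding jumps_def by auto
  ultimately have eq: "n div p ^ t = n div q ^ u" by linarith
  have "p ^ t dvd n" "q ^ u dvd n" using assms(4,5) by (auto simp: jumps_def multiplicity_dvd')
  then have "p ^ t * (n div p ^ t) = n" "q ^ u * (n div p ^ t) = n"
    unfolding eq by (simp_all flip: eq) (simp add: eq)
  moreover from this have "n div p ^ t \<noteq> 0" using assms(1) by (metis mult_0_right not_gr0)
  ultimately have "p ^ t = q ^ u" by (metis mult_right_cancel)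
  then show "p = q" "t = u" using assms prime_power_inj'[of p q t u] by (auto simp: jumps_def)
qed

lemma multiplicity_eq_card:
  fixes x :: int
  assumes "prime p" "x \<noteq> 0"
  shows "multiplicity (int p) x = card {t. 1 \<le> t \<and> int p ^ t dvd x}"
proof -
  have "\<not> is_unit (int p)" using assms(1) by (metis not_prime_unit prime_int_nat_transfer nat_int_comparison(1) prime_nat_int_transfer)
  then have "{t. 1 \<le> t \<and> int p ^ t dvd x} = {1..multiplicity (int p) x}"
    using assms(2) by (auto simp: power_dvd_iff_le_multiplicity)
  then show ?thesis by simp
qed

context
  fixes n :: nat and e E :: "nat \<Rightarrow> int"
  assumes sm: "is_smith_diag n (A_mat n) e"
  defines "E \<equiv> (\<lambda>j. if j = 0 then 1 else e (j - 1))"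
begin

lemma smith_ext_pos: "j \<le> n \<Longrightarrow> E j > 0"
  using smith_diag_pos[OF sm, of "j - 1"] by (auto simp: E_def)

lemma smith_ext_dvd: "1 \<le> j \<Longrightarrow> j \<le> n \<Longrightarrow> E (j - 1) dvd E j"
  using smith_diag_dvd_mono[OF sm, of "j - 2" "j - 1"] by (auto simp: E_def numeral_2_eq_2)

lemma smith_ratio_pos: "1 \<le> j \<Longrightarrow> j \<le> n \<Longrightarrow> E j div E (j - 1) > 0"
  using smith_ext_pos[of j] smith_ext_pos[of "j - 1"] smith_ext_dvd[of j]
  by (metis diff_le_self le_trans pos_imp_zdiv_pos_iff zdvd_imp_le)

text \<open>The strict bound absorbs the shift between \<open>E\<close> and \<open>e\<close>, and at
  j = 0 it gives the empty set, in agreement with \<open>E 0\<close> = 1.\<close>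

lemma multiplicity_smith_ext:
  assumes "prime p" "j \<le> n"
  shows "multiplicity (int p) (E j) = card {t. 1 \<le> t \<and> t \<le> multiplicity p n \<and> n - n div p ^ t < j}"
proof -
  have "{t. 1 \<le> t \<and> int p ^ t dvd E j} = {t. 1 \<le> t \<and> t \<le> multiplicity p n \<and> n - n div p ^ t < j}"
  proof (cases "j = 0")
    case True
    have "\<not> int p ^ t dvd 1" if "1 \<le> t" for t
    proof -
      have "int p ^ t > 1" using that prime_gt_1_nat[OF assms(1)] by (intro one_less_power) auto
      then show ?thesis by simp
    qed
    then show ?thesis using True by (auto simp: E_def)
  next
    case False
    then have "int p ^ t dvd E j \<longleftrightarrow> t \<le> multiplicity p n \<and> n - n div p ^ t \<le> j - 1" if "1 \<le> t" for t
      using prime_power_dvd_smith_diag_iff[OF sm assms(1), of t "j - 1"] that assms(2) by (simp add: E_def)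
    then show ?thesis using False by auto
  qed
  then show ?thesis using multiplicity_eq_card[OF assms(1), of "E j"] smith_ext_pos[OF assms(2)] by simp
qed

text \<open>Passing from j - 1 to j adds exactly those t with n - n/p^t = j - 1, which are the jumps
  at j.\<close>

lemma multiplicity_smith_ratio:
  assumes "prime p" "1 \<le> j" "j \<le> n"
  shows "multiplicity (int p) (E j div E (j - 1)) = card (jumps n p j)"
proof -
  let ?T = "\<lambda>j. {t. 1 \<le> t \<and> t \<le> multiplicity p n \<and> n - n div p ^ t < j}"
  have fin: "finite (?T i)" for i by (rule finite_subset[of _ "{..multiplicity p n}"]) auto
  have T: "?T j = ?T (j - 1) \<union> jumps n p j" using assms(2) by (auto simp: jumps_def)
  have "?T (j - 1) \<inter> jumps n p j = {}" by (auto simp: jumps_def)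
  moreover have "finite (jumps n p j)" using fin[of j] unfolding T by simp
  ultimately have "card (?T j) = card (?T (j - 1)) + card (jumps n p j)"
    unfolding T by (intro card_Un_disjoint fin)
  moreover have "multiplicity (int p) (E j) = multiplicity (int p) (E (j - 1)) + multiplicity (int p) (E j div E (j - 1))"
  proof -
    have "E j = E (j - 1) * (E j div E (j - 1))" using smith_ext_dvd assms by simp
    moreover have "E (j - 1) \<noteq> 0" "E j div E (j - 1) \<noteq> 0"
      using smith_ext_pos[of "j - 1"] smith_ratio_pos[of j] assms by auto
    moreover have "prime_elem (int p)" using assms(1) by auto
    ultimately show ?thesis using prime_elem_multiplicity_mult_distrib by metis
  qed
  ultimately show ?thesis
    using multiplicity_smith_ext[OF assms(1,3)] multiplicity_smith_ext[OF assms(1), of "j - 1"] assms(3) by simp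
qed

text \<open>Both sides are compared prime by prime: p has a single jump at j, and every other prime
  has none.\<close>

lemma smith_ratio_eq_prime:
  assumes "prime p" "1 \<le> j" "j \<le> n" "jumps n p j \<noteq> {}"
  shows "E j div E (j - 1) = int p"
proof (rule multiplicity_eq_int)
  show "E j div E (j - 1) > 0" using assms smith_ratio_pos by blast
  show "int p > 0" using prime_gt_0_nat[OF assms(1)] by simp
  have n: "n > 0" using assms by simp
  obtain t where t: "t \<in> jumps n p j" using assms by blast
  fix q :: int assume q: "prime q"
  then obtain r where r: "q = int r" "prime r" by (metis prime_int_nat_transfer int_nat_eq prime_ge_0_int)
  show "multiplicity q (E j div E (j - 1)) = multiplicity q (int p)"
  proof (cases "r = p")
    case True
    then have "jumps n p j = {t}" using jumps_unique[OF n assms(1,1)] t by blast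
    then show ?thesis using multiplicity_smith_ratio[OF assms(1-3)] True r prime_gt_1_nat[OF assms(1)] by simp
  next
    case False
    then have "jumps n r j = {}" using jumps_unique(1)[OF n r(2) assms(1) _ t] by blast
    then have "multiplicity q (E j div E (j - 1)) = 0" using multiplicity_smith_ratio[OF r(2) assms(2,3)] r by simp
    moreover have "multiplicity q (int p) = 0"
      using False r assms(1) q by (intro not_dvd_imp_multiplicity_0) (auto simp: primes_dvd_imp_eq)
    ultimately show ?thesis by simp
  qed
qed

lemma smith_ratio_eq_1:
  assumes "1 \<le> j" "j \<le> n" "\<And>p. prime p \<Longrightarrow> jumps n p j = {}"
  shows "E j div E (j - 1) = 1"
proof (rule multiplicity_eq_int)
  show "E j div E (j - 1) > 0" using assms smith_ratio_pos by blast
  fix q :: int assume q: "prime q"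
  then obtain r where r: "q = int r" "prime r" by (metis prime_int_nat_transfer int_nat_eq prime_ge_0_int)
  then show "multiplicity q (E j div E (j - 1)) = multiplicity q 1"
    using multiplicity_smith_ratio[OF r(2) assms(1,2)] assms(3)[OF r(2)] by simp
qed simp

lemma smith_ratio_eq_prime_iff:
  assumes "prime p" "1 \<le> j" "j \<le> n"
  shows "E j div E (j - 1) = int p \<longleftrightarrow> jumps n p j \<noteq> {}"
proof
  assume "E j div E (j - 1) = int p"
  then have "card (jumps n p j) = 1"
    using multiplicity_smith_ratio[OF assms] multiplicity_prime[of "int p"] assms(1) by simp
  then show "jumps n p j \<noteq> {}" by auto
qed (use smith_ratio_eq_prime[OF assms] in simp)

text \<open>Sending t to the position where p^t enters is injective on the exponents from 1 to the
  multiplicity, and its values lie between 1 and n because p^t divides n.\<close>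

lemma card_smith_ratio_eq_prime:
  assumes "n > 0" "prime p"
  shows "card {j \<in> {1..n}. E j div E (j - 1) = int p} = multiplicity p n"
proof -
  let ?f = "\<lambda>t. n - n div p ^ t + 1"
  have inj: "inj_on ?f {1..multiplicity p n}"
  proof (rule inj_onI)
    fix t u assume "t \<in> {1..multiplicity p n}" "u \<in> {1..multiplicity p n}" "?f t = ?f u"
    then show "t = u" using jumps_unique(2)[OF assms(1,2,2), of t "?f t" u] by (auto simp: jumps_def)
  qed
  have range: "?f t \<in> {1..n}" if "t \<in> {1..multiplicity p n}" for t
  proof -
    have "p ^ t dvd n" using that by (auto simp: multiplicity_dvd')
    then have "n div p ^ t > 0" using assms(1) by (metis dvd_div_eq_0_iff not_gr0)
    then show ?thesis using assms(1) by auto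
  qed
  have "{j \<in> {1..n}. E j div E (j - 1) = int p} = {j \<in> {1..n}. jumps n p j \<noteq> {}}"
    using smith_ratio_eq_prime_iff[OF assms(2)] by auto
  also have "\<dots> = ?f ` {1..multiplicity p n}"
    using range by (auto simp: jumps_def)
  finally show ?thesis using card_image[OF inj] by simp
qed

text \<open>Every ratio is 1 or a prime, so the counts of the primes fix the part different from 1,
  and the total number n of ratios fixes how many ones remain.\<close>

lemma mset_smith_ratios:
  assumes "n > 0"
  shows "mset (map (\<lambda>j. E j div E (j - 1)) [1..<Suc n]) =
    image_mset int (prime_factorization n) + replicate_mset (n - size (prime_factorization n)) 1"
proof -
  define R where "R = (\<lambda>j. E j div E (j - 1))"
  define M where "M = image_mset R (mset_set {1..n})"
  have M: "mset (map (\<lambda>j. E j div E (j - 1)) [1..<Suc n]) = M"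
    by (simp add: M_def R_def atLeastLessThanSuc_atLeastAtMost del: upt_Suc)
  have count_M: "count M x = card {j \<in> {1..n}. R j = x}" for x
  proof -
    have "count M x = (\<Sum>j | j \<in># mset_set {1..n} \<and> x = R j. count (mset_set {1..n}) j)"
      unfolding M_def by (rule count_image_mset')
    also have "\<dots> = (\<Sum>j\<in>{j \<in> {1..n}. R j = x}. 1)" by (intro sum.cong) auto
    finally show ?thesis by simp
  qed
  have R_cases: "R j = 1 \<or> (\<exists>p. prime p \<and> R j = int p)" if "j \<in> {1..n}" for j
    using smith_ratio_eq_1[of j] smith_ratio_eq_prime[of _ j] that unfolding R_def by fastforce
  have "filter_mset (\<lambda>x. x \<noteq> 1) M = image_mset int (prime_factorization n)"
  proof (rule multiset_eqI)
    fix x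
    show "count (filter_mset (\<lambda>x. x \<noteq> 1) M) x = count (image_mset int (prime_factorization n)) x"
    proof (cases "\<exists>p. prime p \<and> x = int p")
      case True
      then obtain p where p: "prime p" "x = int p" by blast
      then have "x \<noteq> 1" by auto
      then have "count (filter_mset (\<lambda>x. x \<noteq> 1) M) x = multiplicity p n"
        using count_M card_smith_ratio_eq_prime[OF assms p(1)] p(2) by (simp add: R_def)
      moreover have "{y. y \<in># prime_factorization n \<and> int p = int y} =
          (if p \<in># prime_factorization n then {p} else {})" by auto
      then have "count (image_mset int (prime_factorization n)) x = count (prime_factorization n) p"
        unfolding count_image_mset' p(2)
        by (simp add: not_in_iff)
      ultimately show ?thesis using p by (simp add: count_prime_factorization_prime)
    next
      case False
      have "x = 1" if x: "x \<in># M"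
      proof -
        obtain j where "j \<in> {1..n}" "x = R j" using x by (auto simp: M_def)
        then show ?thesis using False R_cases[of j] by blast
      qed
      then have "x \<notin># filter_mset (\<lambda>x. x \<noteq> 1) M" by auto
      moreover have "x \<notin># image_mset int (prime_factorization n)"
        using False by (auto dest: in_prime_factors_imp_prime)
      ultimately show ?thesis unfolding not_in_iff by (rule trans[OF _ sym])
    qed
  qed
  \<comment> \<open>The double negation is the form in which \<open>multiset_partition\<close> gives
    the complementary part.\<close>
  moreover have "filter_mset (\<lambda>x. \<not> x \<noteq> 1) M = replicate_mset (count M 1) 1"
    by (simp add: filter_eq_replicate_mset)
  ultimately have eq: "M = image_mset int (prime_factorization n) + replicate_mset (count M 1) 1"
    using multiset_partition[of M "\<lambda>x. x \<noteq> 1"] by metis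
  have "n = size M" by (simp add: M_def)
  also have "\<dots> = size (prime_factorization n) + count M 1"
    by (subst eq) simp
  finally have "count M 1 = n - size (prime_factorization n)" by simp
  then show ?thesis using M eq by simp
qed

end

theorem theorem2p19:
  fixes n :: nat and e :: "nat \<Rightarrow> int"
  assumes "n > 0"
    and "is_smith_diag n (A_mat n) e"
  defines "E \<equiv> (\<lambda>j. if j = 0 then (1::int) else e (j - 1))"
  shows "mset (map (\<lambda>j. E j div E (j - 1)) [1..<Suc n]) =
           image_mset int (prime_factorization n) + replicate_mset (n - size (prime_factorization n)) 1 \<and>
         (\<forall>p j. prime p \<longrightarrow> p dvd n \<longrightarrow> 1 \<le> j \<longrightarrow> j \<le> n \<longrightarrow>
           (E j div E (j - 1) = int p \<longleftrightarrow>
              (\<exists>t. 1 \<le> t \<and> t \<le> multiplicity p n \<and> j = n - n div p ^ t + 1)))"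
proof (intro conjI allI impI)
  show "mset (map (\<lambda>j. E j div E (j - 1)) [1..<Suc n]) =
    image_mset int (prime_factorization n) + replicate_mset (n - size (prime_factorization n)) 1"
    unfolding E_def by (rule mset_smith_ratios[OF assms(2,1)])
next
  fix p j :: nat assume "prime p" "1 \<le> j" "j \<le> n"
  from smith_ratio_eq_prime_iff[OF assms(2) this]
  show "E j div E (j - 1) = int p \<longleftrightarrow>
      (\<exists>t. 1 \<le> t \<and> t \<le> multiplicity p n \<and> j = n - n div p ^ t + 1)"
    unfolding E_def jumps_def by blast
qed

end
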